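(* Let $p>2$ be a prime number, $k\ge 2$ an integer, $\zeta$ a primitive $p^k$-th root of unity, $H=[\zeta^{a_{ij}}]$ an $n\times n$ normalized Butson-Hadamard matrix, $H'=[a_{ij}]$ (entries in $\mathbb{Z}_{p^k}$), and $N$ the set of all $p^k$-th roots of unity. Let $A_k,B_k,C_k,D_k$ be the codes over $\mathbb{Z}_{p^k}$ obtained from $H$ as described in the context ($D_k$ being considered when $n=p^k$), and let $G_1(A_k),\dots,G_1(D_k)$ be their images under the Gray map $G_1$. Then their minimum Hamming distances satisfy $$d_{G_1(A_k)}=n(p-1)p^{k-2},\qquad d_{G_1(B_k)}=n(p-1)p^{k-2}-p^{k-1},\qquad d_{G_1(C_k)}=n(p-1)p^{k-2},$$ $$d_{G_1(D_k)}\in\{p^{2k-2}(p-1),\ p^{k-2}(p^{k+1}-p^k+p-1)\}.$$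
   Context: A Butson-Hadamard matrix of order $n$ (here with entries $p^k$-th roots of unity) is an $n\times n$ matrix $H$ with $HH^*=nI_n$; it is normalized if its first row and column consist entirely of 1s. Codes: for $u=\zeta^s\in N$ the exponent matrix of $uH$ is $[a_{ij}+s]$ over $\mathbb{Z}_{p^k}$. $A_k$ consists of the rows of $H'$ with the first column deleted; $B_k$ consists of the rows of the exponent matrices of all $uH$, $u\in N$, with the first column deleted; $C_k$ consists of the rows of the exponent matrices of all $uH$, $u\in N$; $D_k$ (for $n=p^k$) consists of the words $(a_{i1}+s,\dots,a_{in}+s,a_{ic})$, $1\le i\le n$, $s\in\mathbb{Z}_{p^k}$, for a fixed noninitial column index $c\in\{2,\dots,n\}$. Gray map $G_1$: for $u\in\mathbb{Z}_{p^k}$ with $p$-ary expansion $u=\sum_{i=1}^k u_ip^{i-1}$, $u_i\in\{0,\dots,p-1\}$, $G_1(u)$ is the function $GF(p)^{k-1}\to GF(p)$, $(y_1,\dots,y_{k-1})\mapsto u_k+\sum_{i=1}^{k-1}u_iy_i$, regarded as a vector of length $p^{k-1}$ over $\mathbb{Z}_p$ (its list of values). $G_1$ is applied to words coordinatewise, with the results concatenated. *)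

theory Defs
  imports
    Complex_Main
    "HOL-Computational_Algebra.Primes"
    "Jordan_Normal_Form.Schur_Decomposition"
begin

definition roots_of_unity :: "nat \<Rightarrow> complex set" where
  "roots_of_unity q = {u. u ^ q = 1}"

definition primitive_root_of_unity :: "nat \<Rightarrow> complex \<Rightarrow> bool" where
  "primitive_root_of_unity q \<zeta> \<longleftrightarrow> \<zeta> ^ q = 1 \<and> (\<forall>m. 0 < m \<and> m < q \<longrightarrow> \<zeta> ^ m \<noteq> 1)"

definition butson_hadamard :: "nat \<Rightarrow> nat \<Rightarrow> complex mat \<Rightarrow> bool" where
  "butson_hadamard q n H \<longleftrightarrow>
     H \<in> carrier_mat n n \<and>
     (\<forall>i<n. \<forall>j<n. H $$ (i, j) \<in> roots_of_unity q) \<and>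
     H * mat_adjoint H = of_nat n \<cdot>\<^sub>m 1\<^sub>m n"

text \<open>Matrix indices start at 0, so the first row and the first column have index 0.\<close>

definition normalized_mat :: "nat \<Rightarrow> complex mat \<Rightarrow> bool" where
  "normalized_mat n H \<longleftrightarrow> (\<forall>j<n. H $$ (0, j) = 1) \<and> (\<forall>i<n. H $$ (i, 0) = 1)"

text \<open>The residues modulo \<open>q\<close> are represented by the natural numbers below \<open>q\<close>. For a primitive
  \<open>q\<close>-th root of unity \<open>\<zeta>\<close>, every \<open>q\<close>-th root of unity is \<open>\<zeta> ^ a\<close> for exactly one such \<open>a\<close>.\<close>

definition exponent :: "complex \<Rightarrow> nat \<Rightarrow> complex \<Rightarrow> nat" where
  "exponent \<zeta> q z = (THE a. a < q \<and> \<zeta> ^ a = z)"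

definition exponent_mat :: "complex \<Rightarrow> nat \<Rightarrow> complex mat \<Rightarrow> nat mat" where
  "exponent_mat \<zeta> q M = map_mat (exponent \<zeta> q) M"

definition row_words :: "'a mat \<Rightarrow> 'a list set" where
  "row_words M = list_of_vec ` set (rows M)"

definition code_A :: "complex \<Rightarrow> nat \<Rightarrow> complex mat \<Rightarrow> nat list set" where
  "code_A \<zeta> q H = tl ` row_words (exponent_mat \<zeta> q H)"

definition code_B :: "complex \<Rightarrow> nat \<Rightarrow> complex mat \<Rightarrow> nat list set" where
  "code_B \<zeta> q H = (\<Union>u\<in>roots_of_unity q. tl ` row_words (exponent_mat \<zeta> q (u \<cdot>\<^sub>m H)))"

definition code_C :: "complex \<Rightarrow> nat \<Rightarrow> complex mat \<Rightarrow> nat list set" where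
  "code_C \<zeta> q H = (\<Union>u\<in>roots_of_unity q. row_words (exponent_mat \<zeta> q (u \<cdot>\<^sub>m H)))"

definition code_D :: "complex \<Rightarrow> nat \<Rightarrow> nat \<Rightarrow> complex mat \<Rightarrow> nat list set" where
  "code_D \<zeta> q c H =
     (let H' = exponent_mat \<zeta> q H
      in {map (\<lambda>j. (H' $$ (i, j) + s) mod q) [0..<dim_col H'] @ [H' $$ (i, c)] | i s.
            i < dim_row H' \<and> s < q})"

text \<open>The \<open>i\<close>-th digit, \<open>i \<ge> 1\<close>, belongs to \<open>p ^ (i - 1)\<close>.\<close>

definition digit :: "nat \<Rightarrow> nat \<Rightarrow> nat \<Rightarrow> nat" where
  "digit p u i = u div p ^ (i - 1) mod p"

text \<open>The points of \<open>GF(p)^(k - 1)\<close> are the lists of length \<open>k - 1\<close> over \<open>[0..<p]\<close>, in the order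
  in which \<open>List.n_lists\<close> enumerates them; \<open>y\<^sub>i\<close> is \<open>y ! (i - 1)\<close>.\<close>

definition gray :: "nat \<Rightarrow> nat \<Rightarrow> nat \<Rightarrow> nat list" where
  "gray p k u =
     map (\<lambda>y. (digit p u k + (\<Sum>i = 1..k - 1. digit p u i * y ! (i - 1))) mod p)
       (List.n_lists (k - 1) [0..<p])"

definition gray_word :: "nat \<Rightarrow> nat \<Rightarrow> nat list \<Rightarrow> nat list" where
  "gray_word p k w = concat (map (gray p k) w)"

definition hamming_dist :: "'a list \<Rightarrow> 'a list \<Rightarrow> nat" where
  "hamming_dist v w = card {i. i < length v \<and> v ! i \<noteq> w ! i}"

text \<open>Meaningful only for a finite code with at least two words, all of the same length.\<close>

definition min_dist :: "'a list set \<Rightarrow> nat" where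
  "min_dist C = Min {hamming_dist v w | v w. v \<in> C \<and> w \<in> C \<and> v \<noteq> w}"

lemma exponent_eqI:
  assumes \<zeta>: "primitive_root_of_unity q \<zeta>" and a: "a < q" "\<zeta> ^ a = z"
  shows "exponent \<zeta> q z = a"
proof -
  have le: "x = y" if xy: "x \<le> y" "y < q" "\<zeta> ^ x = \<zeta> ^ y" for x y :: nat
  proof (rule ccontr)
    assume "x \<noteq> y"
    with xy have m: "0 < y - x" "y - x < q" by auto
    from \<zeta> m have nz: "\<zeta> \<noteq> 0" by (auto simp: primitive_root_of_unity_def power_0_left)
    have "\<zeta> ^ y = \<zeta> ^ x * \<zeta> ^ (y - x)"
      using xy(1) by (simp flip: power_add)
    with xy(3) have "\<zeta> ^ x * \<zeta> ^ (y - x) = \<zeta> ^ x * 1" by simp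
    with nz have "\<zeta> ^ (y - x) = 1" by simp
    with \<zeta> m show False by (auto simp: primitive_root_of_unity_def)
  qed
  show ?thesis
    unfolding exponent_def
  proof (rule the_equality)
    fix b assume b: "b < q \<and> \<zeta> ^ b = z"
    show "b = a"
    proof (cases "b \<le> a")
      case True
      then show ?thesis using le[of b a] a b by simp
    next
      case False
      then show ?thesis using le[of a b] a b by simp
    qed
  qed (use a in simp)
qed

text \<open>For \<open>H = [\<zeta> ^ a\<^sub>i\<^sub>j]\<close> and \<open>u = \<zeta> ^ s\<close>, the exponent matrix of \<open>uH\<close> is \<open>[a\<^sub>i\<^sub>j + s]\<close>.\<close>

lemma exponent_mat_smult:
  assumes \<zeta>: "primitive_root_of_unity q \<zeta>" and q: "q > 0"
  shows "exponent_mat \<zeta> q (\<zeta> ^ s \<cdot>\<^sub>m map_mat (\<lambda>a. \<zeta> ^ a) M) = map_mat (\<lambda>a. (a + s) mod q) M"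
proof -
  have "exponent \<zeta> q (\<zeta> ^ s * \<zeta> ^ a) = (a + s) mod q" for a
  proof (rule exponent_eqI[OF \<zeta>])
    show "(a + s) mod q < q" using q by simp
    have "\<zeta> ^ (a + s) = \<zeta> ^ (q * ((a + s) div q) + (a + s) mod q)" by simp
    also have "\<dots> = \<zeta> ^ ((a + s) mod q)"
      using \<zeta> by (simp only: power_add power_mult primitive_root_of_unity_def) simp
    finally show "\<zeta> ^ ((a + s) mod q) = \<zeta> ^ s * \<zeta> ^ a" by (simp add: power_add mult.commute)
  qed
  then show ?thesis by (auto simp: exponent_mat_def)
qed

end

theory Submission
  imports Defs "HOL-Number_Theory.Cong"
begin

text \<open>
  Two distinct affine functions on \<open>GF(p) ^ (k - 1)\<close> differ everywhere if they have the same linear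
  part, and otherwise on all but \<open>p ^ (k - 2)\<close> points. So the Hamming distance of the Gray images of
  \<open>u \<noteq> v\<close> is \<open>p ^ (k - 1)\<close> if \<open>u\<close> and \<open>v\<close> agree modulo \<open>p ^ (k - 1)\<close>, and \<open>p ^ (k - 2) * (p - 1)\<close> otherwise.
  The entrywise quotients of two distinct rows of \<open>H\<close> form a vanishing sum of \<open>p ^ k\<close>-th roots of unity.
  By irreducibility of the cyclotomic polynomial every coset of the subgroup of order \<open>p\<close> is hit
  uniformly by them, so that the Gray images of multiples of distinct rows always have the same distance
  \<open>n * (p - 1) * p ^ (k - 2)\<close>. Two shifts of the same row are at least that far apart, with
  equality for the shifts of the first row by 0 and 1. Deleting the first column loses at most
  \<open>p ^ (k - 1)\<close>. Appending an unshifted column does not change the distance of shifts of the same row,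
  so the first of the two values listed for the code \<open>D\<close> is always the right one.
\<close>

subsection \<open>Vanishing sums of roots of unity of prime power order\<close>

text \<open>The constant terms multiply to \<open>p\<close>, so exactly one factor has a constant
  term divisible by \<open>p\<close>. Its first coefficient prime to \<open>p\<close> forces a
  coefficient of \<open>F\<close> prime to \<open>p\<close> at the same index, which by
  \<open>low\<close> is at least \<open>degree F\<close>.\<close>

lemma eisenstein_factor:
  fixes F g h :: "int poly" and p :: nat
  assumes p: "prime p" and lead: "lead_coeff F = 1"
    and low: "\<And>i. i < degree F \<Longrightarrow> int p dvd coeff F i"
    and const: "coeff F 0 = int p"
    and F: "F = g * h"
  shows "degree g = 0 \<or> degree h = 0"
proof -
  have pp: "prime (int p)" using p by simp
  have *: "degree h' = 0"
    if gh: "F = g' * h'" and pg: "int p dvd coeff g' 0" for g' h' :: "int poly"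
  proof -
    have nz: "g' \<noteq> 0" "h' \<noteq> 0" using gh lead by auto
    have c0: "coeff g' 0 * coeff h' 0 = int p"
      using const gh by (simp add: coeff_mult)
    have ph: "\<not> int p dvd coeff h' 0"
    proof
      assume "int p dvd coeff h' 0"
      with pg have "int p * int p dvd int p" unfolding c0[symmetric] by (rule mult_dvd_mono)
      then have "p * p dvd p" by (metis int_dvd_int_iff of_nat_mult)
      then show False using prime_gt_1_nat[OF p] by (auto dest: dvd_imp_le)
    qed
    have "lead_coeff g' * lead_coeff h' = 1" using gh lead by (simp add: lead_coeff_mult)
    then have "is_unit (lead_coeff g')" by (metis dvd_triv_left)
    then have ex: "\<exists>i. \<not> int p dvd coeff g' i" using pp by (meson dvd_trans not_prime_unit)
    define i where "i = (LEAST i. \<not> int p dvd coeff g' i)"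
    have i: "\<not> int p dvd coeff g' i" unfolding i_def using ex by (rule LeastI_ex)
    have less: "int p dvd coeff g' j" if "j < i" for j
      using that not_less_Least unfolding i_def by blast
    have "coeff F i = (\<Sum>j\<le>i. coeff g' j * coeff h' (i - j))"
      using gh by (simp add: coeff_mult)
    also have "\<dots> = (\<Sum>j<i. coeff g' j * coeff h' (i - j)) + coeff g' i * coeff h' 0"
      by (simp flip: lessThan_Suc_atMost)
    finally have eq: "coeff F i = \<dots>" .
    have "int p dvd (\<Sum>j<i. coeff g' j * coeff h' (i - j))"
      by (intro dvd_sum) (use less in auto)
    then have "\<not> int p dvd coeff F i"
      using i ph pp unfolding eq by (simp add: dvd_add_right_iff prime_dvd_mult_iff)
    then have "degree F \<le> i" using low not_less by blast
    moreover have "i \<le> degree g'" using i by (metis dvd_0_right le_degree)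
    moreover have "degree F = degree g' + degree h'" using gh nz by (simp add: degree_mult_eq)
    ultimately show ?thesis by simp
  qed
  have "int p dvd coeff g 0 * coeff h 0"
    using const F by (simp add: coeff_mult)
  then have "int p dvd coeff g 0 \<or> int p dvd coeff h 0"
    using pp by (simp add: prime_dvd_mult_iff)
  then show ?thesis using *[of g h] *[of h g] F by (auto simp: mult.commute)
qed

text \<open>A nonzero annihilating polynomial of least degree, made primitive, divides \<open>F\<close> by Gauss's lemma.\<close>

lemma eisenstein_root_degree:
  fixes F G :: "int poly" and p :: nat and x :: complex
  assumes p: "prime p" and lead: "lead_coeff F = 1"
    and low: "\<And>i. i < degree F \<Longrightarrow> int p dvd coeff F i"
    and const: "coeff F 0 = int p"
    and Fx: "poly (of_int_poly F) x = 0"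
    and G: "G \<noteq> 0" and Gx: "poly (of_int_poly G) x = 0"
  shows "degree F \<le> degree G"
proof -
  define P where "P g \<longleftrightarrow> g \<noteq> 0 \<and> poly (of_int_poly g) x = 0" for g :: "int poly"
  have "P G" using G Gx by (simp add: P_def)
  then obtain g0 where g0: "P g0" and min: "\<And>g. P g \<Longrightarrow> degree g0 \<le> degree g"
    using exists_least_iff[of "\<lambda>d. \<exists>g. P g \<and> degree g = d"] by (metis not_le)
  define g where "g = primitive_part g0"
  have dg: "degree g = degree g0" by (simp add: g_def)
  have g0x: "g0 \<noteq> 0" "poly (of_int_poly g0) x = 0" using g0 by (auto simp: P_def)
  have gnz: "g \<noteq> 0" using g0x by (simp add: g_def)
  have "g0 = smult (content g0) g" by (simp add: g_def)
  then have "of_int (content g0) * poly (of_int_poly g) x = 0"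
    using g0x(2) by (metis of_int_hom.map_poly_hom_smult poly_smult)
  then have gx: "poly (of_int_poly g) x = 0" using g0x(1) by simp
  have cg: "content g = 1" using g0x by (simp add: g_def)
  \<comment> \<open>Pseudo-division keeps coefficients integral at the price of the factor
    \<open>a\<close>. The remainder vanishes at \<open>x\<close>, so minimality makes it 0.\<close>
  obtain a q where a: "a \<noteq> 0" and eq: "smult a F = g * q + pseudo_mod F g"
    using pseudo_mod(1)[OF gnz, of F] by blast
  have "poly (of_int_poly (smult a F)) x = poly (of_int_poly (g * q + pseudo_mod F g)) x"
    by (simp only: eq)
  then have "poly (of_int_poly (pseudo_mod F g)) x = 0"
    using Fx gx by (simp add: hom_distribs)
  then have r: "pseudo_mod F g = 0"
    using pseudo_mod(2)[OF gnz, of F] min[of "pseudo_mod F g"] dg unfolding P_def by linarith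
  \<comment> \<open>Contents multiply and \<open>g\<close> is primitive, so \<open>a\<close> divides
    \<open>q\<close> and cancels.\<close>
  have "content (smult a F) = content (g * q)" using eq r by simp
  then have "a dvd content q" by (simp add: content_mult cg) (metis dvd_triv_left abs_dvd_iff)
  then obtain q' where q': "q = [:a:] * q'"
    by (metis const_poly_dvd_iff_dvd_content dvdE)
  then have "smult a F = smult a (g * q')" using eq r by simp
  then have F: "F = g * q'"
    using a by (metis smult_eq_0_iff smult_diff_right right_minus_eq)
  have Fnz: "F \<noteq> 0" using lead by auto
  have "degree g \<noteq> 0"
  proof
    assume "degree g = 0"
    then obtain c where "g = [:c:]" by (rule degree_eq_zeroE)
    then show False using gx gnz by simp
  qed
  then have "degree q' = 0" using eisenstein_factor[OF p lead low const F] by simp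
  then have "degree F = degree g" using F Fnz by (simp add: degree_mult_eq)
  then show ?thesis using min[OF \<open>P G\<close>] dg by simp
qed

section \<open>Cyclotomic polynomials of prime power order\<close>

text \<open>Iterated Frobenius: modulo \<open>p\<close>, taking \<open>p\<close>-th powers preserves
  congruences and is additive, as the inner binomial coefficients vanish.\<close>

lemma prime_power_binomial_cong:
  fixes p :: nat
  assumes p: "prime p"
  shows "[:int p:] dvd [:1, 1:] ^ (p ^ m) - (monom 1 (p ^ m) + 1)"
proof (induction m)
  case 0
  then show ?case by (simp add: monom_altdef one_pCons)
next
  case (Suc m)
  have p0: "p > 0" using p by (rule prime_gt_0_nat)
  let ?A = "[:1, 1:] ^ (p ^ m) :: int poly" and ?B = "monom 1 (p ^ m) + 1 :: int poly"
  have "?A - ?B dvd ?A ^ p - ?B ^ p"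
    by (metis dvd_triv_left power_diff_sumr2)
  with Suc have 1: "[:int p:] dvd ?A ^ p - ?B ^ p" by (rule dvd_trans)
  let ?t = "\<lambda>i. of_nat (p choose i) * monom 1 (p ^ m) ^ i * 1 ^ (p - i) :: int poly"
  have "?B ^ p = (\<Sum>i\<le>p. ?t i)" by (rule binomial_ring)
  also have "{..p} = insert 0 (insert p {1..<p})" using p0 by auto
  also have "sum ?t \<dots> = 1 + (monom 1 (p ^ m) ^ p + (\<Sum>i = 1..<p. ?t i))"
    using p0 by simp
  finally have eq: "?B ^ p - (monom 1 (p ^ Suc m) + 1) = (\<Sum>i = 1..<p. ?t i)"
    by (simp add: monom_power mult.commute)
  have "[:int p:] dvd ?t i" if i: "i \<in> {1..<p}" for i
  proof -
    have "p dvd p choose i" using i p by (intro dvd_choose_prime) auto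
    then obtain c where "p choose i = p * c" by (rule dvdE)
    then have "?t i = [:int p:] * (of_nat c * monom 1 (p ^ m) ^ i)" by (simp add: of_nat_poly mult.commute)
    then show ?thesis by (rule dvdI)
  qed
  then have 2: "[:int p:] dvd ?B ^ p - (monom 1 (p ^ Suc m) + 1)"
    unfolding eq by (intro dvd_sum)
  have "([:1, 1:] :: int poly) ^ (p ^ Suc m) = ?A ^ p"
    by (simp add: mult.commute flip: power_mult)
  then show ?case using dvd_add[OF 1 2] by (simp only: diff_add_cancel add_diff_eq)
qed

text \<open>For \<open>M = p ^ m\<close> this is the cyclotomic polynomial of order \<open>p ^ (m + 1)\<close> at \<open>X + 1\<close>.\<close>

definition shifted_cyclotomic :: "nat \<Rightarrow> nat \<Rightarrow> int poly" where
  "shifted_cyclotomic p M = (\<Sum>i<p. ([:1, 1:] ^ M) ^ i)"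

lemma shifted_cyclotomic_mult:
  "shifted_cyclotomic p M * ([:1, 1:] ^ M - 1) = [:1, 1:] ^ (M * p) - 1"
  using power_diff_1_eq[of "[:1, 1:] ^ M :: int poly" p]
  by (simp add: shifted_cyclotomic_def power_mult mult.commute[of "sum _ _"])

lemma linear_power_minus_one:
  assumes "M > 0"
  shows "degree ([:1, 1:] ^ M - 1 :: int poly) = M" "lead_coeff ([:1, 1:] ^ M - 1 :: int poly) = 1"
proof -
  have d: "degree ([:1, 1:] ^ M :: int poly) = M" by (simp add: degree_power_eq)
  show 1: "degree ([:1, 1:] ^ M - 1 :: int poly) = M"
    using degree_add_eq_left[of "-1 :: int poly" "[:1, 1:] ^ M"] d assms by simp
  have "lead_coeff ([:1, 1:] ^ M :: int poly) = 1" by (simp add: lead_coeff_power)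
  then show "lead_coeff ([:1, 1:] ^ M - 1 :: int poly) = 1"
    using assms 1 d by simp
qed

text \<open>Both sides of \<open>shifted_cyclotomic_mult\<close> are compared. Modulo
  \<open>p\<close> it says that \<open>F\<close> times \<open>X ^ M\<close> is
  \<open>X ^ (M * p)\<close>, where \<open>M = p ^ m\<close>, which leaves only the leading term of
  \<open>F\<close>.\<close>

lemma shifted_cyclotomic_eisenstein:
  fixes p m i :: nat
  assumes p: "prime p"
  defines "F \<equiv> shifted_cyclotomic p (p ^ m)"
  shows "degree F = p ^ m * (p - 1)" "lead_coeff F = 1" "coeff F 0 = int p"
    "i < degree F \<Longrightarrow> int p dvd coeff F i"
proof -
  let ?M = "p ^ m"
  have p0: "p > 0" using p by (rule prime_gt_0_nat)
  have M: "?M > 0" "?M * p > 0" using p0 by auto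
  have eq: "F * ([:1, 1:] ^ ?M - 1) = [:1, 1:] ^ (?M * p) - 1"
    unfolding F_def by (rule shifted_cyclotomic_mult)
  have "lead_coeff (F * ([:1, 1:] ^ ?M - 1)) = 1"
    unfolding eq using linear_power_minus_one(2)[OF M(2)] .
  then show lead: "lead_coeff F = 1"
    using linear_power_minus_one(2)[OF M(1)] by (simp add: lead_coeff_mult)
  have "degree (F * ([:1, 1:] ^ ?M - 1)) = ?M * p"
    unfolding eq using linear_power_minus_one(1)[OF M(2)] .
  moreover have "F \<noteq> 0" "[:1, 1:] ^ ?M - 1 \<noteq> (0 :: int poly)"
    using lead linear_power_minus_one(2)[OF M(1)] by force+
  ultimately have "degree F + ?M = ?M * p"
    using linear_power_minus_one(1)[OF M(1)] by (simp add: degree_mult_eq)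
  then show deg: "degree F = ?M * (p - 1)" by (simp add: diff_mult_distrib2)
  show "coeff F 0 = int p"
    by (simp add: F_def shifted_cyclotomic_def coeff_0_power flip: poly_0_coeff_0)
      (simp add: poly_sum)
  show "int p dvd coeff F i" if i: "i < degree F"
  proof -
    have "F * monom 1 ?M - monom 1 (?M * p)
        = ([:1, 1:] ^ (?M * p) - (monom 1 (?M * p) + 1)) - F * ([:1, 1:] ^ ?M - (monom 1 ?M + 1))"
      using eq by (simp add: algebra_simps)
    also have "[:int p:] dvd \<dots>"
      by (rule dvd_diff[OF _ dvd_mult])
        (use prime_power_binomial_cong[OF p, of "Suc m"] prime_power_binomial_cong[OF p, of m]
         in \<open>simp_all only: power_Suc mult.commute[of p]\<close>)
    \<comment> \<open>At index \<open>?M + i\<close> the product carries \<open>coeff F i\<close>;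
      the index is below \<open>?M * p\<close>, so the subtracted monomial is absent.\<close>
    finally have "int p dvd coeff (F * monom 1 ?M - monom 1 (?M * p)) (?M + i)"
      by (simp only: const_poly_dvd_iff)
    moreover have "?M + i < ?M * p" using i deg \<open>degree F + ?M = ?M * p\<close> by simp
    ultimately show ?thesis by (simp add: coeff_monom_mult mult.commute[of F])
  qed
qed

text \<open>The power \<open>\<zeta> ^ (p ^ m)\<close> is a nontrivial \<open>p\<close>-th root of
  unity, so \<open>\<zeta> - 1\<close> is a root of the shifted cyclotomic polynomial. Substituting
  \<open>X + 1\<close> in \<open>g\<close> keeps its degree and moves its root there.\<close>

lemma primitive_root_prime_power_degree:
  fixes p m :: nat and g :: "int poly"
  assumes p: "prime p" and z: "primitive_root_of_unity (p ^ Suc m) \<zeta>"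
    and g: "g \<noteq> 0" and gz: "poly (of_int_poly g) \<zeta> = 0"
  shows "p ^ m * (p - 1) \<le> degree g"
proof -
  let ?F = "shifted_cyclotomic p (p ^ m)" and ?h = "g \<circ>\<^sub>p [:1, 1:]"
  have p1: "p > 1" using p by (rule prime_gt_1_nat)
  have "p ^ m < p ^ Suc m" "p ^ m > 0" using p1 by auto
  then have "\<zeta> ^ (p ^ m) \<noteq> 1" using z by (auto simp: primitive_root_of_unity_def)
  moreover have "(\<zeta> ^ (p ^ m)) ^ p = 1"
    using z by (simp add: primitive_root_of_unity_def flip: power_mult) (simp add: mult.commute)
  then have "(\<zeta> ^ (p ^ m) - 1) * (\<Sum>i<p. (\<zeta> ^ (p ^ m)) ^ i) = 0"
    by (simp flip: power_diff_1_eq)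
  ultimately have "(\<Sum>i<p. (\<zeta> ^ (p ^ m)) ^ i) = 0" by simp
  then have F: "poly (of_int_poly ?F) (\<zeta> - 1) = 0"
    by (simp add: shifted_cyclotomic_def poly_sum hom_distribs)
  have h: "poly (of_int_poly ?h) (\<zeta> - 1) = 0"
    using gz by (simp add: of_int_hom.map_poly_pcompose poly_pcompose)
  have "?h \<noteq> 0" using g by (subst pcompose_eq_0_iff) auto
  from eisenstein_root_degree[OF p shifted_cyclotomic_eisenstein(2)[OF p]
      shifted_cyclotomic_eisenstein(4)[OF p] shifted_cyclotomic_eisenstein(3)[OF p] F this h]
  show ?thesis using shifted_cyclotomic_eisenstein(1)[OF p] by (simp add: degree_pcompose)
qed

text \<open>Write \<open>M = p ^ m\<close>. Subtracting multiples of \<open>\<zeta> ^ y * (\<Sum>i<p. \<zeta> ^ (M * i)) = 0\<close> for \<open>y < M\<close>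
  leaves a relation of degree less than \<open>M * (p - 1)\<close>, which must be trivial.\<close>

lemma vanishing_sum_coeffs:
  fixes p m :: nat and c :: "nat \<Rightarrow> int"
  assumes p: "prime p" and z: "primitive_root_of_unity (p ^ Suc m) \<zeta>"
    and sum0: "(\<Sum>x<p ^ Suc m. of_int (c x) * \<zeta> ^ x) = 0" and i: "i < p"
  shows "c (p ^ m * i) = c 0"
proof -
  define M where "M = p ^ m"
  have p1: "p > 1" using p by (rule prime_gt_1_nat)
  have M: "M > 0" using p1 by (simp add: M_def)
  have pM: "M * p = p ^ Suc m" by (simp add: M_def mult.commute)
  have sp: "(\<Sum>i<p. f i) = (\<Sum>i<p - Suc 0. f i) + f (p - Suc 0)" for f :: "nat \<Rightarrow> complex"
    using p1 by (cases p) simp_all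
  have reindex: "(\<Sum>x<M * r. f x) = (\<Sum>y<M. \<Sum>i<r. f (M * i + y))" for f :: "nat \<Rightarrow> complex" and r
  proof -
    have "(\<Sum>x<M * r. f x) = (\<Sum>i<r. \<Sum>y<M. f (M * i + y))"
    proof -
      have "sum f {i * M..<i * M + M} = (\<Sum>y<M. f (M * i + y))" for i
        using sum.shift_bounds_nat_ivl[of f 0 "i * M" M] by (simp add: lessThan_atLeast0 ac_simps)
      then show ?thesis using sum.nat_group[of f M r] by (simp add: mult.commute)
    qed
    then show ?thesis by (simp only: sum.swap[of _ "{..<M}"])
  qed
  \<comment> \<open>From each block of \<open>M\<close> coefficients the top block is subtracted. So
    \<open>e\<close> vanishes on the top block, and summing over \<open>p - 1\<close> or
    \<open>p\<close> blocks is the same.\<close>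
  define e where "e x = c x - c (M * (p - 1) + x mod M)" for x
  have "\<zeta> ^ M \<noteq> 1"
    using z p1 M by (auto simp: primitive_root_of_unity_def M_def)
  moreover have "(\<zeta> ^ M) ^ p = 1"
    using z by (simp add: primitive_root_of_unity_def pM flip: power_mult)
  then have "(\<zeta> ^ M - 1) * (\<Sum>i<p. (\<zeta> ^ M) ^ i) = 0"
    by (simp flip: power_diff_1_eq)
  ultimately have cyc: "(\<Sum>i<p. (\<zeta> ^ M) ^ i) = 0" by simp
  have "(\<Sum>x<M * (p - 1). of_int (e x) * \<zeta> ^ x)
      = (\<Sum>y<M. \<Sum>i<p - 1. of_int (e (M * i + y)) * \<zeta> ^ (M * i + y))" by (rule reindex)
  also have "\<dots> = (\<Sum>y<M. \<Sum>i<p. of_int (e (M * i + y)) * \<zeta> ^ (M * i + y))"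
    unfolding sp by (simp add: e_def)
  also have "\<dots> = (\<Sum>y<M. (\<Sum>i<p. of_int (c (M * i + y)) * \<zeta> ^ (M * i + y))
      - of_int (c (M * (p - 1) + y)) * \<zeta> ^ y * (\<Sum>i<p. (\<zeta> ^ M) ^ i))"
  proof (intro sum.cong refl)
    fix y assume "y \<in> {..<M}"
    then have "(\<Sum>i<p. of_int (e (M * i + y)) * \<zeta> ^ (M * i + y))
        = (\<Sum>i<p. of_int (c (M * i + y)) * \<zeta> ^ (M * i + y)
            - of_int (c (M * (p - 1) + y)) * \<zeta> ^ y * (\<zeta> ^ M) ^ i)"
      by (intro sum.cong refl) (simp add: e_def power_add left_diff_distrib flip: power_mult)
    then show "(\<Sum>i<p. of_int (e (M * i + y)) * \<zeta> ^ (M * i + y))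
        = (\<Sum>i<p. of_int (c (M * i + y)) * \<zeta> ^ (M * i + y))
          - of_int (c (M * (p - 1) + y)) * \<zeta> ^ y * (\<Sum>i<p. (\<zeta> ^ M) ^ i)"
      by (simp only: sum_subtractf sum_distrib_left)
  qed
  also have "\<dots> = (\<Sum>x<M * p. of_int (c x) * \<zeta> ^ x)" by (simp add: cyc reindex)
  also have "\<dots> = 0" using sum0 by (simp only: pM)
  finally have e0: "(\<Sum>x<M * (p - 1). of_int (e x) * \<zeta> ^ x) = 0" .
  define g where "g = (\<Sum>x<M * (p - 1). monom (e x) x)"
  have gz: "poly (of_int_poly g) \<zeta> = 0"
    using e0 by (simp add: g_def hom_distribs poly_sum poly_monom)
  have co: "coeff g x = (if x < M * (p - 1) then e x else 0)" for x
    by (simp add: g_def coeff_sum)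
  have "g = 0"
  proof (rule ccontr)
    assume g: "g \<noteq> 0"
    then have "M * (p - 1) \<le> degree g"
      using primitive_root_prime_power_degree[OF p z g gz] by (simp add: M_def)
    then show False using co[of "degree g"] g by simp
  qed
  then have "e x = 0" if "x < M * (p - 1)" for x using co[of x] that by simp
  then have eq: "c (M * j) = c (M * (p - 1))" if "j < p" for j
    using that M by (cases "j = p - 1") (auto simp: e_def)
  show ?thesis using eq[OF i] eq[of 0] p1 by (simp add: M_def)
qed

text \<open>Terms are grouped by exponent, \<open>c x\<close> being the multiplicity of
  \<open>x\<close>. The multiples of \<open>p ^ m\<close> in range are the \<open>p\<close>
  exponents \<open>p ^ m * i\<close>, all as frequent as 0.\<close>

lemma vanishing_sum_card:
  fixes p m n :: nat and d :: "nat \<Rightarrow> nat"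
  assumes p: "prime p" and z: "primitive_root_of_unity (p ^ Suc m) \<zeta>"
    and d: "\<And>j. j < n \<Longrightarrow> d j < p ^ Suc m" and sum0: "(\<Sum>j<n. \<zeta> ^ d j) = 0"
  shows "card {j. j < n \<and> p ^ m dvd d j} = p * card {j. j < n \<and> d j = 0}"
proof -
  define c where "c x = card {j. j < n \<and> d j = x}" for x
  have M: "p ^ m > 0" using prime_gt_0_nat[OF p] by simp
  have "(\<Sum>x<p ^ Suc m. of_int (int (c x)) * \<zeta> ^ x)
      = (\<Sum>x<p ^ Suc m. \<Sum>j\<in>{j\<in>{..<n}. d j = x}. \<zeta> ^ d j)"
    by (intro sum.cong refl) (simp add: c_def)
  also have "\<dots> = (\<Sum>j<n. \<zeta> ^ d j)" by (rule sum.group) (use d in auto)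
  finally have "(\<Sum>x<p ^ Suc m. of_int (int (c x)) * \<zeta> ^ x) = 0" using sum0 by simp
  note * = vanishing_sum_coeffs[OF p z this]
  have "{j. j < n \<and> p ^ m dvd d j} = (\<Union>i<p. {j. j < n \<and> d j = p ^ m * i})"
    using d by (fastforce elim!: dvdE simp: mult.commute)
  also have "card \<dots> = (\<Sum>i<p. c (p ^ m * i))"
    unfolding c_def using M by (intro card_UN_disjoint) auto
  also have "\<dots> = p * c 0" using * by simp
  finally show ?thesis by (simp add: c_def)
qed

subsection \<open>The Gray map\<close>

lemma hamming_dist_append:
  assumes "length xs = length ys"
  shows "hamming_dist (xs @ xs') (ys @ ys') = hamming_dist xs ys + hamming_dist xs' ys'"
proof -
  let ?l = "length xs"
  have "{i. i < length (xs @ xs') \<and> (xs @ xs') ! i \<noteq> (ys @ ys') ! i}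
      = {i. i < ?l \<and> xs ! i \<noteq> ys ! i} \<union> (\<lambda>i. i + ?l) ` {i. i < length xs' \<and> xs' ! i \<noteq> ys' ! i}"
    (is "?A = ?B \<union> _ ` ?C")
  proof (intro equalityI subsetI)
    fix i assume "i \<in> ?A"
    then show "i \<in> ?B \<union> (\<lambda>i. i + ?l) ` ?C"
      using assms by (cases "i < ?l") (auto simp: nth_append intro!: image_eqI[of _ _ "i - ?l"])
  qed (use assms in \<open>auto simp: nth_append\<close>)
  then have "card ?A = card ?B + card ((\<lambda>i. i + ?l) ` ?C)"
    by (simp only:) (rule card_Un_disjoint, auto)
  then show ?thesis by (simp add: hamming_dist_def card_image)
qed

lemma hamming_dist_map:
  assumes "distinct xs"
  shows "hamming_dist (map f xs) (map g xs) = card {x \<in> set xs. f x \<noteq> g x}"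
proof -
  have "{x \<in> set xs. f x \<noteq> g x} = (!) xs ` {i. i < length xs \<and> f (xs ! i) \<noteq> g (xs ! i)}"
    by (auto simp: in_set_conv_nth)
  moreover have "inj_on ((!) xs) {i. i < length xs \<and> f (xs ! i) \<noteq> g (xs ! i)}"
    by (rule inj_on_subset[OF inj_on_nth[OF assms, of "{..<length xs}"]]) auto
  moreover have "{i. i < length (map f xs) \<and> map f xs ! i \<noteq> map g xs ! i}
      = {i. i < length xs \<and> f (xs ! i) \<noteq> g (xs ! i)}" by auto
  ultimately show ?thesis by (simp only: hamming_dist_def card_image)
qed

lemma distinct_n_lists:
  assumes "distinct xs"
  shows "distinct (List.n_lists m xs)"
proof (induction m)
  case (Suc m)
  then show ?case
    using assms by (auto simp: distinct_map inj_on_def intro!: distinct_concat)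
qed simp

lemma set_n_lists_Suc:
  "set (List.n_lists (Suc m) xs) = (\<lambda>(x, ys). x # ys) ` (set xs \<times> set (List.n_lists m xs))"
  by (auto simp: image_iff)

lemma card_n_lists:
  assumes "distinct xs"
  shows "card (set (List.n_lists m xs)) = length xs ^ m"
  using distinct_card[OF distinct_n_lists[OF assms]] by (simp add: length_n_lists)

section \<open>Affine hyperplanes over GF(p)\<close>

lemma unique_linear_solution:
  fixes p :: nat and a b :: int
  assumes p: "prime p" and a: "\<not> int p dvd a"
  shows "card {x \<in> {..<p}. int p dvd a * int x + b} = 1"
proof -
  have "coprime a (int p)" using prime_imp_coprime[of "int p" a] a p by (simp add: coprime_commute)
  then obtain u where u: "[a * u = 1] (mod int p)" using cong_solve_coprime_int by blast
  define x where "x = nat ((- b * u) mod int p)"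
  have p0: "int p > 0" using prime_gt_0_nat[OF p] by simp
  have ix: "int x = (- b * u) mod int p" using p0 by (simp add: x_def)
  have "[a * int x + b = a * (- b * u) + b] (mod int p)"
    unfolding ix by (intro cong_add cong_mult cong_refl) (simp add: cong_def)
  also have "[a * (- b * u) + b = - b * (a * u) + b] (mod int p)" by (simp add: algebra_simps)
  also have "[- b * (a * u) + b = - b * 1 + b] (mod int p)" by (intro cong_add cong_mult cong_refl u)
  finally have sol: "int p dvd a * int x + b" by (simp add: cong_0_iff)
  have xp: "x < p" using p0 ix by (metis pos_mod_bound nat_int_comparison(2))
  have "y = x" if y: "y < p" "int p dvd a * int y + b" for y
  proof -
    have "int p dvd a * (int y - int x)" using dvd_diff[OF y(2) sol] by (simp add: algebra_simps)
    then have "int p dvd int y - int x" using a p by (simp add: prime_dvd_mult_iff)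
    then have "[int y = int x] (mod int p)" by (simp add: cong_iff_dvd_diff)
    then show ?thesis using y(1) xp by (simp add: cong_int_iff cong_def)
  qed
  then have "{x \<in> {..<p}. int p dvd a * int x + b} = {x}" using xp sol by blast
  then show ?thesis by simp
qed

text \<open>If \<open>p\<close> divides \<open>d 0\<close>, the first coordinate is free and only
  changes the constant, so \<open>c\<close> is generalized in the induction. Otherwise the remaining
  coordinates determine the first one.\<close>

lemma card_affine_hyperplane:
  fixes p :: nat and d :: "nat \<Rightarrow> int" and c :: int
  assumes p: "prime p" and "\<exists>i<m. \<not> int p dvd d i"
  shows "card {y \<in> set (List.n_lists m [0..<p]). int p dvd c + (\<Sum>i<m. d i * int (y ! i))} = p ^ (m - 1)"
  using assms(2)
proof (induction m arbitrary: d c)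
  case 0
  then show ?case by simp
next
  case (Suc m)
  let ?L = "set (List.n_lists m [0..<p])"
  have p0: "p > 0" using p by (rule prime_gt_0_nat)
  have fin: "finite ?L" by simp
  have S: "{y \<in> set (List.n_lists (Suc m) [0..<p]). int p dvd c + (\<Sum>i<Suc m. d i * int (y ! i))}
     = (\<lambda>(x, ys). x # ys) ` {(x, ys). x < p \<and> ys \<in> ?L \<and>
         int p dvd (c + d 0 * int x) + (\<Sum>i<m. d (Suc i) * int (ys ! i))}"
    unfolding set_n_lists_Suc by (auto simp: sum.lessThan_Suc_shift add.assoc simp del: sum.lessThan_Suc)
  have inj: "inj_on (\<lambda>(x, ys). x # ys) A" for A :: "(nat \<times> nat list) set" by (auto simp: inj_on_def)
  show ?case
  proof (cases "int p dvd d 0")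
    case True
    then have ex: "\<exists>i<m. \<not> int p dvd d (Suc i)"
      using Suc.prems by (metis less_Suc_eq_0_disj)
    \<comment> \<open>Keeps \<open>m - 1\<close> from truncating, so that
      \<open>p * p ^ (m - 1)\<close> is \<open>p ^ m\<close>.\<close>
    then have m: "m > 0" by auto
    have "{(x, ys). x < p \<and> ys \<in> ?L \<and>
         int p dvd (c + d 0 * int x) + (\<Sum>i<m. d (Suc i) * int (ys ! i))}
       = (SIGMA x:{..<p}. {ys \<in> ?L. int p dvd (c + d 0 * int x) + (\<Sum>i<m. d (Suc i) * int (ys ! i))})"
      by auto
    then have "card {y \<in> set (List.n_lists (Suc m) [0..<p]). int p dvd c + (\<Sum>i<Suc m. d i * int (y ! i))}
       = card (SIGMA x:{..<p}. {ys \<in> ?L. int p dvd (c + d 0 * int x) + (\<Sum>i<m. d (Suc i) * int (ys ! i))})"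
      unfolding S card_image[OF inj] by (simp only:)
    also have "\<dots> = (\<Sum>x<p. card {ys \<in> ?L. int p dvd (c + d 0 * int x) + (\<Sum>i<m. d (Suc i) * int (ys ! i))})"
      by (rule card_SigmaI) auto
    also have "\<dots> = p * p ^ (m - 1)" unfolding Suc.IH[OF ex] by simp
    also have "\<dots> = p ^ (Suc m - 1)" using m by (cases m) simp_all
    finally show ?thesis .
  next
    case False
    \<comment> \<open>Here the fibres are taken over the tail, hence the swapped pairs.\<close>
    have "{(x, ys). x < p \<and> ys \<in> ?L \<and>
         int p dvd (c + d 0 * int x) + (\<Sum>i<m. d (Suc i) * int (ys ! i))}
       = prod.swap ` (SIGMA ys:?L. {x \<in> {..<p}. int p dvd d 0 * int x + (c + (\<Sum>i<m. d (Suc i) * int (ys ! i)))})"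
      by (auto simp: image_iff algebra_simps)
    then have "card {y \<in> set (List.n_lists (Suc m) [0..<p]). int p dvd c + (\<Sum>i<Suc m. d i * int (y ! i))}
       = card (SIGMA ys:?L. {x \<in> {..<p}. int p dvd d 0 * int x + (c + (\<Sum>i<m. d (Suc i) * int (ys ! i)))})"
      unfolding S card_image[OF inj] by (simp only: card_image[OF inj_swap])
    also have "\<dots> = (\<Sum>ys\<in>?L. card {x \<in> {..<p}. int p dvd d 0 * int x + (c + (\<Sum>i<m. d (Suc i) * int (ys ! i)))})"
      by (rule card_SigmaI) auto
    also have "\<dots> = p ^ m"
      unfolding unique_linear_solution[OF p False] using card_n_lists[of "[0..<p]" m] by simp
    finally show ?thesis by simp
  qed
qed

section \<open>Digits and distances of Gray images\<close>

lemma mod_power_eq_iff_digits: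
  fixes p u v :: nat
  assumes "p > 0"
  shows "u mod p ^ m = v mod p ^ m \<longleftrightarrow> (\<forall>i<m. digit p u (Suc i) = digit p v (Suc i))"
proof (induction m)
  case (Suc m)
  have *: "x mod p ^ Suc m = p ^ m * digit p x (Suc m) + x mod p ^ m" for x
    by (simp add: digit_def mod_mult2_eq mult.commute[of p])
  have "u mod p ^ Suc m = v mod p ^ Suc m \<longleftrightarrow>
     digit p u (Suc m) = digit p v (Suc m) \<and> u mod p ^ m = v mod p ^ m"
  proof
    assume eq: "u mod p ^ Suc m = v mod p ^ Suc m"
    have "x mod p ^ Suc m mod p ^ m = x mod p ^ m" for x
      by (simp add: mod_mod_cancel)
    then have low: "u mod p ^ m = v mod p ^ m" using eq by metis
    then have "p ^ m * digit p u (Suc m) = p ^ m * digit p v (Suc m)"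
      using eq unfolding * by simp
    then show "digit p u (Suc m) = digit p v (Suc m) \<and> u mod p ^ m = v mod p ^ m"
      using low assms by simp
  qed (simp only: *)
  then show ?case unfolding Suc.IH by (metis less_Suc_eq)
qed simp

text \<open>Agreement modulo \<open>p ^ (k - 1)\<close> means that the digits 1 to
  \<open>k - 1\<close> coincide, that is, the linear parts of the two affine functions.\<close>

definition gray_dist :: "nat \<Rightarrow> nat \<Rightarrow> nat \<Rightarrow> nat \<Rightarrow> nat" where
  "gray_dist p k u v = (if u = v then 0 else if u mod p ^ (k - 1) = v mod p ^ (k - 1) then p ^ (k - 1)
     else p ^ (k - 2) * (p - 1))"

text \<open>The difference of the two functions is affine, with constant \<open>?c\<close> and
  coefficients \<open>?d\<close>. It is either constant modulo \<open>p\<close>, or its zeros form a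
  hyperplane whose complement is counted.\<close>

lemma hamming_dist_gray:
  assumes p: "prime p" and k: "k \<ge> 2" and uv: "u < p ^ k" "v < p ^ k"
  shows "hamming_dist (gray p k u) (gray p k v) = gray_dist p k u v"
proof -
  obtain m where k': "k = Suc (Suc m)" using k by (metis Suc_le_D numeral_2_eq_2 Suc_le_mono)
  define L where "L = set (List.n_lists (Suc m) [0..<p])"
  let ?d = "\<lambda>i. int (digit p u (Suc i)) - int (digit p v (Suc i))"
  let ?c = "int (digit p u k) - int (digit p v k)"
  have p0: "p > 0" using p by (rule prime_gt_0_nat)
  have digit_less: "digit p x i < p" for x i using p0 by (simp add: digit_def)
  have dz: "int p dvd int (digit p u i) - int (digit p v i) \<longleftrightarrow> digit p u i = digit p v i" for i
    using digit_less[of u i] digit_less[of v i]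
    by (simp add: cong_iff_dvd_diff[symmetric] cong_int_iff cong_def)
  have cardL: "card L = p ^ Suc m" using card_n_lists[of "[0..<p]" "Suc m"] unfolding L_def by simp
  define f where "f x y = digit p x k + (\<Sum>i<Suc m. digit p x (Suc i) * y ! i)"
    for x and y :: "nat list"
  have gray: "gray p k x = map (\<lambda>y. f x y mod p) (List.n_lists (Suc m) [0..<p])" for x
    by (simp only: gray_def f_def k' One_nat_def diff_Suc_Suc minus_nat.diff_0 sum.atLeast1_atMost_eq)
  have "?c + (\<Sum>i<Suc m. ?d i * int (y ! i)) = int (f u y) - int (f v y)" for y
    by (simp only: f_def of_nat_add of_nat_sum of_nat_mult left_diff_distrib sum_subtractf)
  then have ne: "f u y mod p \<noteq> f v y mod p
      \<longleftrightarrow> \<not> int p dvd ?c + (\<Sum>i<Suc m. ?d i * int (y ! i))" for y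
    by (simp only: cong_iff_dvd_diff[symmetric] cong_int_iff) (simp only: cong_def)
  have "hamming_dist (gray p k u) (gray p k v)
      = card {y \<in> L. \<not> int p dvd ?c + (\<Sum>i<Suc m. ?d i * int (y ! i))}"
    unfolding gray hamming_dist_map[OF distinct_n_lists[OF distinct_upt]] L_def by (simp only: ne)
  also have "\<dots> = gray_dist p k u v"
  proof (cases "u mod p ^ Suc m = v mod p ^ Suc m")
    case True
    then have d: "?d i = 0" if "i < Suc m" for i
      using that unfolding mod_power_eq_iff_digits[OF p0] by simp
    \<comment> \<open>The lower digits being equal, \<open>u\<close> and \<open>v\<close> differ
      exactly if \<open>?c\<close> is nonzero modulo \<open>p\<close>.\<close>
    have "u = v \<longleftrightarrow> u mod p ^ k = v mod p ^ k" using uv by simp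
    also have "\<dots> \<longleftrightarrow> digit p u k = digit p v k"
      using True unfolding k' mod_power_eq_iff_digits[OF p0] by (metis less_Suc_eq)
    finally have "u = v \<longleftrightarrow> int p dvd ?c" using dz by simp
    then show ?thesis using True d cardL by (auto simp: gray_dist_def k')
  next
    case False
    then have "\<exists>i<Suc m. \<not> int p dvd ?d i" unfolding mod_power_eq_iff_digits[OF p0] dz by simp
    from card_affine_hyperplane[OF p this]
    have H: "card {y \<in> L. int p dvd ?c + (\<Sum>i<Suc m. ?d i * int (y ! i))} = p ^ m"
      unfolding L_def by simp
    have "{y \<in> L. \<not> int p dvd ?c + (\<Sum>i<Suc m. ?d i * int (y ! i))}
       = L - {y \<in> L. int p dvd ?c + (\<Sum>i<Suc m. ?d i * int (y ! i))}" by auto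
    then have "card {y \<in> L. \<not> int p dvd ?c + (\<Sum>i<Suc m. ?d i * int (y ! i))} = p ^ Suc m - p ^ m"
      using H cardL by (simp only:) (subst card_Diff_subset, auto simp: L_def)
    then show ?thesis using False by (auto simp: gray_dist_def k' algebra_simps diff_mult_distrib2)
  qed
  finally show ?thesis .
qed

lemma length_gray: "length (gray p k u) = p ^ (k - 1)"
  by (simp add: gray_def length_n_lists)

lemma hamming_dist_gray_word:
  assumes p: "prime p" and k: "k \<ge> 2" and "length v = length w"
    and "set v \<subseteq> {..<p ^ k}" "set w \<subseteq> {..<p ^ k}"
  shows "hamming_dist (gray_word p k v) (gray_word p k w)
    = (\<Sum>j<length v. gray_dist p k (v ! j) (w ! j))"
  using assms(3-)
proof (induction v w rule: list_induct2)
  case Nil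
  then show ?case by (simp add: gray_word_def hamming_dist_def)
next
  case (Cons x xs y ys)
  have "hamming_dist (gray_word p k (x # xs)) (gray_word p k (y # ys))
      = hamming_dist (gray p k x @ gray_word p k xs) (gray p k y @ gray_word p k ys)"
    by (simp add: gray_word_def)
  also have "\<dots> = gray_dist p k x y + (\<Sum>j<length xs. gray_dist p k (xs ! j) (ys ! j))"
    using Cons.IH Cons.prems hamming_dist_gray[OF p k, of x y]
    by (simp add: hamming_dist_append length_gray)
  finally show ?case by (simp add: sum.lessThan_Suc_shift del: sum.lessThan_Suc)
qed

subsection \<open>Distances in the codes\<close>

lemma primitive_root_power_mod:
  assumes "primitive_root_of_unity q \<zeta>"
  shows "\<zeta> ^ (a mod q) = \<zeta> ^ a"
proof -
  have "\<zeta> ^ a = \<zeta> ^ (q * (a div q) + a mod q)" by simp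
  also have "\<dots> = \<zeta> ^ (a mod q)"
    using assms by (simp only: power_add power_mult primitive_root_of_unity_def) simp
  finally show ?thesis by simp
qed

lemma primitive_root_inj_on:
  assumes "primitive_root_of_unity q \<zeta>"
  shows "inj_on (\<lambda>s. \<zeta> ^ s) {..<q}"
  by (rule inj_on_inverseI[of _ "exponent \<zeta> q"]) (auto intro: exponent_eqI[OF assms])

text \<open>By counting: the \<open>q\<close> powers are distinct, and there are exactly
  \<open>q\<close> roots.\<close>

lemma roots_of_unity_eq_powers:
  assumes z: "primitive_root_of_unity q \<zeta>" and q: "q > 0"
  shows "roots_of_unity q = (\<lambda>s. \<zeta> ^ s) ` {..<q}"
proof -
  have "card {u::complex. u ^ q = 1} = q" by (rule card_roots_unity_eq) (use q in auto)
  moreover have "card ((\<lambda>s. \<zeta> ^ s) ` {..<q}) = q"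
    using primitive_root_inj_on[OF z] by (simp add: card_image)
  moreover have "(\<zeta> ^ s) ^ q = 1" for s
    using z by (metis power_mult mult.commute power_one primitive_root_of_unity_def)
  ultimately have "(\<lambda>s. \<zeta> ^ s) ` {..<q} = {u. u ^ q = 1}"
    using q by (intro card_subset_eq) (auto intro!: card_ge_0_finite)
  then show ?thesis by (simp add: roots_of_unity_def)
qed

text \<open>The upper bound limits the loss from deleting a coordinate; the lower one serves shifts
  of one row, which differ in every coordinate.\<close>

lemma gray_dist_bounds:
  assumes "k \<ge> 2"
  shows "gray_dist p k u v \<le> p ^ (k - 1)"
    "u \<noteq> v \<Longrightarrow> p ^ (k - 2) * (p - 1) \<le> gray_dist p k u v"
proof -
  have "p ^ (k - 1) = p ^ (k - 2) * p"
    using assms by (metis Suc_diff_le diff_Suc_1 diff_Suc_eq_diff_pred numeral_2_eq_2 power_Suc2 Suc_1)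
  then have *: "p ^ (k - 2) * (p - 1) \<le> p ^ (k - 1)" by simp
  show "gray_dist p k u v \<le> p ^ (k - 1)" using * by (simp add: gray_dist_def)
  show "p ^ (k - 2) * (p - 1) \<le> gray_dist p k u v" if "u \<noteq> v"
    using * that by (simp add: gray_dist_def)
qed

text \<open>If \<open>t\<close> differences vanish, then \<open>p * t\<close> of them are multiples of \<open>p ^ (k - 1)\<close>, and the sum is
  \<open>(p - 1) * t * p ^ (k - 1) + (n - p * t) * p ^ (k - 2) * (p - 1)\<close>, in which \<open>t\<close> cancels.\<close>

lemma sum_gray_dist_orthogonal:
  fixes p k n :: nat and u v :: "nat \<Rightarrow> nat"
  assumes p: "prime p" and k: "k \<ge> 2" and z: "primitive_root_of_unity (p ^ k) \<zeta>"
    and u: "\<And>j. j < n \<Longrightarrow> u j < p ^ k" and v: "\<And>j. j < n \<Longrightarrow> v j < p ^ k"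
    and orth: "(\<Sum>j<n. \<zeta> ^ u j * cnj (\<zeta> ^ v j)) = 0"
  shows "(\<Sum>j<n. gray_dist p k (u j) (v j)) = n * (p - 1) * p ^ (k - 2)"
proof -
  obtain m where k': "k = Suc (Suc m)" using k by (metis Suc_le_D numeral_2_eq_2 Suc_le_mono)
  define q where "q = p ^ k"
  define M where "M = p ^ Suc m"
  have p0: "p > 0" using p by (rule prime_gt_0_nat)
  have Mq: "M dvd q" by (simp add: M_def q_def k')
  have q0: "q > 0" using p0 by (simp add: q_def)
  have zq: "\<zeta> ^ q = 1" using z by (simp add: primitive_root_of_unity_def q_def)
  \<comment> \<open>On the unit circle conjugation is inversion, so each product in
    \<open>orth\<close> is a single power of \<zeta>.\<close>
  have "norm \<zeta> ^ q = 1" using zq by (metis norm_one norm_power)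
  then have "norm \<zeta> = 1" using q0 power_eq_imp_eq_base[of "norm \<zeta>" q 1] by simp
  then have cn: "\<zeta> * cnj \<zeta> = 1" by (simp add: complex_norm_square[symmetric])
  have cnp: "\<zeta> ^ x * cnj (\<zeta> ^ x) = 1" for x
    using cn by (metis complex_cnj_power power_mult_distrib power_one)
  \<comment> \<open>The difference of the exponents modulo \<open>q\<close>; \<open>q - v j\<close>
    is exact for \<open>j < n\<close>, since \<open>v j < q\<close>.\<close>
  define d where "d j = (u j + (q - v j)) mod q" for j
  have eq: "\<zeta> ^ d j = \<zeta> ^ u j * cnj (\<zeta> ^ v j)" if j: "j < n" for j
  proof -
    have "\<zeta> ^ (q - v j) * \<zeta> ^ v j = 1"
      using v[OF j] zq by (simp add: q_def flip: power_add)
    then have "\<zeta> ^ (q - v j) = cnj (\<zeta> ^ v j)"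
      using cnp[of "v j"] by (metis mult.assoc mult.commute mult_1)
    then show ?thesis
      using primitive_root_power_mod[OF z] by (simp add: d_def q_def power_add)
  qed
  have d0: "d j = 0 \<longleftrightarrow> u j = v j" if j: "j < n" for j
  proof -
    have "d j = 0 \<longleftrightarrow> \<zeta> ^ d j = \<zeta> ^ 0"
      using inj_onD[OF primitive_root_inj_on[OF z], of "d j" 0] q0 by (auto simp: d_def q_def)
    also have "\<dots> \<longleftrightarrow> \<zeta> ^ u j * cnj (\<zeta> ^ v j) = 1" by (simp add: eq[OF j])
    also have "\<dots> \<longleftrightarrow> \<zeta> ^ u j = \<zeta> ^ v j"
      using cnp by (metis mult.assoc mult.commute mult_1)
    also have "\<dots> \<longleftrightarrow> u j = v j"
      using inj_onD[OF primitive_root_inj_on[OF z], of "u j" "v j"] u[OF j] v[OF j] by auto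
    finally show ?thesis .
  qed
  have dM: "M dvd d j \<longleftrightarrow> u j mod M = v j mod M" if j: "j < n" for j
  proof -
    have "M dvd d j \<longleftrightarrow> M dvd u j + (q - v j)"
      using Mq by (simp add: d_def dvd_mod_iff)
    also have "\<dots> \<longleftrightarrow> int M dvd int (u j) - int (v j) + int q"
      using v[OF j] by (simp add: q_def of_nat_diff algebra_simps flip: int_dvd_int_iff)
    also have "\<dots> \<longleftrightarrow> int M dvd int (u j) - int (v j)"
      using Mq by (simp add: dvd_add_left_iff)
    also have "\<dots> \<longleftrightarrow> u j mod M = v j mod M"
      by (simp add: cong_iff_dvd_diff[symmetric] cong_int_iff) (simp add: cong_def)
    finally show ?thesis .
  qed
  define Z where "Z = {j. j < n \<and> d j = 0}"
  define T where "T = {j. j < n \<and> M dvd d j}"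
  have fin: "finite T" "finite Z" by (auto simp: T_def Z_def)
  have cT: "card T = p * card Z"
    unfolding T_def Z_def M_def
  proof (rule vanishing_sum_card[OF p])
    show "primitive_root_of_unity (p ^ Suc (Suc m)) \<zeta>" using z by (simp only: k')
    show "d j < p ^ Suc (Suc m)" for j using q0 by (simp add: d_def flip: k' q_def)
    show "(\<Sum>j<n. \<zeta> ^ d j) = 0" using orth eq by simp
  qed
  have ZT: "Z \<subseteq> T" "T \<subseteq> {..<n}" by (auto simp: T_def Z_def)
  \<comment> \<open>Makes \<open>n - p * card Z\<close> exact, as the final cancellation
    requires.\<close>
  then have cTn: "p * card Z \<le> n" using card_mono[of "{..<n}" T] cT by simp
  let ?b = "p ^ m * (p - 1)"
  have gd: "gray_dist p k x y = (if x = y then 0 else if x mod M = y mod M then M else ?b)" for x y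
    by (simp add: gray_dist_def k' M_def)
  have "(\<Sum>j<n. gray_dist p k (u j) (v j))
      = (\<Sum>j<n. (if j \<in> T - Z then M else 0) + (if j \<in> {..<n} - T then ?b else 0))"
    by (intro sum.cong refl) (auto simp: gd T_def Z_def d0 dM)
  also have "\<dots> = card (T - Z) * M + card ({..<n} - T) * ?b"
  proof -
    have *: "(\<Sum>j<n. if j \<in> A then w else 0) = card A * w" if "A \<subseteq> {..<n}" for A and w :: nat
      using sum.inter_restrict[of "{..<n}" "\<lambda>_. w" A] that by (simp add: Int_absorb1)
    show ?thesis
      unfolding sum.distrib by (intro arg_cong2[of _ _ _ _ "(+)"] *) (use ZT in auto)
  qed
  also have "card (T - Z) = (p - 1) * card Z"
    using ZT fin by (simp add: card_Diff_subset cT diff_mult_distrib)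
  also have "card ({..<n} - T) = n - p * card Z"
    using ZT fin by (simp add: card_Diff_subset cT)
  also have "(p - 1) * card Z * M + (n - p * card Z) * ?b = (p * card Z + (n - p * card Z)) * ?b"
    by (simp add: M_def algebra_simps)
  also have "\<dots> = n * (p - 1) * p ^ (k - 2)" using cTn by (simp add: k')
  finally show ?thesis .
qed

section \<open>Minimum distance from a witness pair and a lower bound\<close>

text \<open>The condition \<open>m > 0\<close> also separates the witnesses, since equal words have
  distance 0.\<close>

lemma min_dist_eqI:
  assumes "finite C" and "v \<in> C" "w \<in> C" "hamming_dist v w = m" "m > 0"
    and "\<And>x y. x \<in> C \<Longrightarrow> y \<in> C \<Longrightarrow> x \<noteq> y \<Longrightarrow> m \<le> hamming_dist x y"
  shows "min_dist C = m"
  unfolding min_dist_def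
proof (rule Min_eqI)
  have "{hamming_dist v w |v w. v \<in> C \<and> w \<in> C \<and> v \<noteq> w} \<subseteq> (\<lambda>(v, w). hamming_dist v w) ` (C \<times> C)"
    by auto
  then show "finite {hamming_dist v w |v w. v \<in> C \<and> w \<in> C \<and> v \<noteq> w}"
    by (rule finite_subset) (use assms(1) in simp)
  have "v \<noteq> w" using assms(4,5) by (auto simp: hamming_dist_def)
  then show "m \<in> {hamming_dist v w |v w. v \<in> C \<and> w \<in> C \<and> v \<noteq> w}" using assms(2-4) by auto
qed (use assms(6) in auto)

text \<open>Distinct Gray images come from distinct words, so a bound over pairs of words in
  \<open>C\<close> suffices.\<close>

lemma min_dist_gray_eqI:
  assumes p: "prime p" and k: "k \<ge> 2" and fin: "finite C"
    and len: "\<And>w. w \<in> C \<Longrightarrow> length w = L" and set: "\<And>w. w \<in> C \<Longrightarrow> set w \<subseteq> {..<p ^ k}"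
    and vw: "v \<in> C" "w \<in> C" "(\<Sum>j<L. gray_dist p k (v ! j) (w ! j)) = m" "m > 0"
    and le: "\<And>x y. x \<in> C \<Longrightarrow> y \<in> C \<Longrightarrow> x \<noteq> y \<Longrightarrow> m \<le> (\<Sum>j<L. gray_dist p k (x ! j) (y ! j))"
  shows "min_dist (gray_word p k ` C) = m"
proof -
  have H: "hamming_dist (gray_word p k x) (gray_word p k y) = (\<Sum>j<L. gray_dist p k (x ! j) (y ! j))"
    if "x \<in> C" "y \<in> C" for x y
    using hamming_dist_gray_word[OF p k, of x y] that len set by simp
  show ?thesis
  proof (rule min_dist_eqI)
    show "hamming_dist (gray_word p k v) (gray_word p k w) = m" using H vw by simp
    show "m \<le> hamming_dist x y" if "x \<in> gray_word p k ` C" "y \<in> gray_word p k ` C" "x \<noteq> y" for x y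
      using that H le by force
  qed (use fin vw in auto)
qed

lemma row_words_mat:
  "row_words (mat m n f) = (\<lambda>i. map (\<lambda>j. f (i, j)) [0..<n]) ` {..<m}"
proof -
  have "row_words (mat m n f) = (\<lambda>i. list_of_vec (row (mat m n f) i)) ` {..<m}"
    by (simp add: row_words_def rows_def image_image lessThan_atLeast0)
  also have "\<dots> = (\<lambda>i. map (\<lambda>j. f (i, j)) [0..<n]) ` {..<m}"
    by (intro image_cong refl nth_equalityI) (auto simp: list_of_vec_index)
  finally show ?thesis .
qed

lemma add_mod_neq:
  fixes b s s' q :: nat
  assumes "s < q" "s' < q" "s \<noteq> s'"
  shows "(b + s) mod q \<noteq> (b + s') mod q"
  using assms cong_add_lcancel_nat[of b s s' q] by (auto simp: cong_def)

section \<open>The codes in terms of rows and shifts\<close>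

locale normalized_butson =
  fixes p k n :: nat and \<zeta> :: complex and H :: "complex mat"
  assumes p: "prime p" and p2: "p > 2" and k: "k \<ge> 2" and n: "n \<ge> 1"
    and z: "primitive_root_of_unity (p ^ k) \<zeta>"
    and butson: "butson_hadamard (p ^ k) n H"
    and normalized: "normalized_mat n H"
begin

definition a :: "nat \<Rightarrow> nat \<Rightarrow> nat" where "a i j = exponent \<zeta> (p ^ k) (H $$ (i, j))"

text \<open>Row \<open>i\<close> of the exponent matrix of
  \<open>\<zeta> ^ s \<cdot>\<^sub>m H\<close>; all four codes are built from these words.\<close>

definition word :: "nat \<Rightarrow> nat \<Rightarrow> nat list" where
  "word i s = map (\<lambda>j. (a i j + s) mod p ^ k) [0..<n]"

lemma q_pos: "p ^ k > 0" using p2 by simp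

lemma H_carrier: "H \<in> carrier_mat n n" using butson by (simp add: butson_hadamard_def)

lemma a_less: "i < n \<Longrightarrow> j < n \<Longrightarrow> a i j < p ^ k"
  and power_a: "i < n \<Longrightarrow> j < n \<Longrightarrow> \<zeta> ^ a i j = H $$ (i, j)"
proof -
  assume "i < n" "j < n"
  then have "H $$ (i, j) \<in> (\<lambda>s. \<zeta> ^ s) ` {..<p ^ k}"
    using butson roots_of_unity_eq_powers[OF z q_pos] by (simp add: butson_hadamard_def)
  then obtain s where s: "s < p ^ k" "\<zeta> ^ s = H $$ (i, j)" by auto
  then have "a i j = s" using exponent_eqI[OF z] by (simp add: a_def)
  then show "a i j < p ^ k" "\<zeta> ^ a i j = H $$ (i, j)" using s by auto
qed

lemma a_0: "j < n \<Longrightarrow> a 0 j = 0" "i < n \<Longrightarrow> a i 0 = 0"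
  using normalized exponent_eqI[OF z q_pos, of 1] by (auto simp: a_def normalized_mat_def)

lemma exponent_mat_H: "exponent_mat \<zeta> (p ^ k) H = mat n n (\<lambda>(i, j). a i j)"
  using H_carrier by (auto simp: exponent_mat_def a_def)

lemma exponent_mat_smult_H:
  "exponent_mat \<zeta> (p ^ k) (\<zeta> ^ s \<cdot>\<^sub>m H) = mat n n (\<lambda>(i, j). (a i j + s) mod p ^ k)"
proof -
  have "H = map_mat (\<lambda>e. \<zeta> ^ e) (mat n n (\<lambda>(i, j). a i j))"
    using H_carrier by (auto simp: power_a)
  then have "exponent_mat \<zeta> (p ^ k) (\<zeta> ^ s \<cdot>\<^sub>m H)
      = map_mat (\<lambda>e. (e + s) mod p ^ k) (mat n n (\<lambda>(i, j). a i j))"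
    using exponent_mat_smult[OF z q_pos] by metis
  then show ?thesis by auto
qed

lemma code_C_eq: "code_C \<zeta> (p ^ k) H = (\<lambda>(i, s). word i s) ` ({..<n} \<times> {..<p ^ k})"
  unfolding code_C_def roots_of_unity_eq_powers[OF z q_pos]
  by (auto simp: exponent_mat_smult_H row_words_mat word_def)

lemma code_B_eq: "code_B \<zeta> (p ^ k) H = (\<lambda>(i, s). tl (word i s)) ` ({..<n} \<times> {..<p ^ k})"
  unfolding code_B_def roots_of_unity_eq_powers[OF z q_pos]
  by (auto simp: exponent_mat_smult_H row_words_mat word_def image_image)

lemma code_A_eq: "code_A \<zeta> (p ^ k) H = (\<lambda>i. tl (word i 0)) ` {..<n}"
  unfolding code_A_def exponent_mat_H row_words_mat image_image
  by (intro image_cong refl arg_cong[of _ _ tl]) (simp add: word_def a_less)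

lemma code_D_eq:
  assumes "c < n"
  shows "code_D \<zeta> (p ^ k) c H = (\<lambda>(i, s). word i s @ [a i c]) ` ({..<n} \<times> {..<p ^ k})"
proof -
  have eq: "map (\<lambda>j. (mat n n (\<lambda>(i, j). a i j) $$ (i, j) + s) mod p ^ k) [0..<n]
      @ [mat n n (\<lambda>(i, j). a i j) $$ (i, c)] = word i s @ [a i c]" if "i < n" for i s
    using that assms by (simp add: word_def)
  have "code_D \<zeta> (p ^ k) c H = {word i s @ [a i c] | i s. i < n \<and> s < p ^ k}"
    unfolding code_D_def exponent_mat_H Let_def dim_row_mat dim_col_mat
    by (intro Collect_cong ex_cong1) (metis eq)
  then show ?thesis by auto
qed

lemma rows_orthogonal:
  assumes "i < n" "i' < n" "i \<noteq> i'"
  shows "(\<Sum>j<n. \<zeta> ^ a i j * cnj (\<zeta> ^ a i' j)) = 0"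
proof -
  have "(H * mat_adjoint H) $$ (i, i') = 0"
    using butson assms by (simp add: butson_hadamard_def)
  moreover have "(H * mat_adjoint H) $$ (i, i') = (\<Sum>j<n. H $$ (i, j) * cnj (H $$ (i', j)))"
    using H_carrier assms
    by (simp add: mat_adjoint_def scalar_prod_def mat_of_rows_def lessThan_atLeast0)
  ultimately show ?thesis using assms by (simp add: power_a)
qed

lemma length_word [simp]: "length (word i s) = n"
  by (simp add: word_def)

lemma nth_word: "j < n \<Longrightarrow> word i s ! j = (a i j + s) mod p ^ k"
  by (simp add: word_def)

lemma set_word: "set (word i s) \<subseteq> {..<p ^ k}"
  using q_pos by (auto simp: word_def)

definition word_dist :: "nat list \<Rightarrow> nat list \<Rightarrow> nat" where
  "word_dist v w = (\<Sum>j<n. gray_dist p k (v ! j) (w ! j))"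

text \<open>The shifts multiply the inner product of the rows by a constant, so orthogonality
  persists.\<close>

lemma word_dist_rows:
  assumes "i < n" "i' < n" "i \<noteq> i'"
  shows "word_dist (word i s) (word i' s') = n * (p - 1) * p ^ (k - 2)"
  unfolding word_dist_def
proof (rule sum_gray_dist_orthogonal[OF p k z])
  have "\<zeta> ^ (word i s ! j) * cnj (\<zeta> ^ (word i' s' ! j))
      = (\<zeta> ^ s * cnj (\<zeta> ^ s')) * (\<zeta> ^ a i j * cnj (\<zeta> ^ a i' j))" if "j < n" for j
    using that by (simp add: nth_word primitive_root_power_mod[OF z] power_add del: complex_cnj_power)
  then have "(\<Sum>j<n. \<zeta> ^ (word i s ! j) * cnj (\<zeta> ^ (word i' s' ! j)))
      = (\<zeta> ^ s * cnj (\<zeta> ^ s')) * (\<Sum>j<n. \<zeta> ^ a i j * cnj (\<zeta> ^ a i' j))"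
    unfolding sum_distrib_left by (intro sum.cong) auto
  then show "(\<Sum>j<n. \<zeta> ^ (word i s ! j) * cnj (\<zeta> ^ (word i' s' ! j))) = 0"
    using rows_orthogonal[OF assms] by simp
qed (use q_pos in \<open>simp_all add: nth_word\<close>)

lemma word_dist_shift:
  assumes "s < p ^ k" "s' < p ^ k" "s \<noteq> s'"
  shows "n * (p - 1) * p ^ (k - 2) \<le> word_dist (word i s) (word i s')"
proof -
  have "(\<Sum>j<n. p ^ (k - 2) * (p - 1)) \<le> word_dist (word i s) (word i s')"
    unfolding word_dist_def
    by (intro sum_mono gray_dist_bounds(2)[OF k]) (simp add: nth_word add_mod_neq[OF assms])
  then show ?thesis by (simp add: mult.commute mult.left_commute)
qed

lemma word_dist_ge:
  assumes "i < n" "i' < n" "s < p ^ k" "s' < p ^ k" "(i, s) \<noteq> (i', s')"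
  shows "n * (p - 1) * p ^ (k - 2) \<le> word_dist (word i s) (word i' s')"
  using assms word_dist_rows[of i i' s s'] word_dist_shift[of s s' i] by (cases "i = i'") auto

lemma one_less_q: "1 < p ^ k"
  using one_less_power[of p k] p2 k by linarith

text \<open>These words are constantly 0 and constantly 1. As \<open>k \<ge> 2\<close>, 0 and 1
  differ modulo \<open>p ^ (k - 1)\<close>, so every coordinate contributes the lower bound. This
  witness pair exists even for \<open>n = 1\<close>.\<close>

lemma word_dist_first_row: "word_dist (word 0 0) (word 0 1) = n * (p - 1) * p ^ (k - 2)"
proof -
  have "1 < p ^ (k - 1)" using one_less_power[of p "k - 1"] p2 k by linarith
  then have "gray_dist p k 0 1 = p ^ (k - 2) * (p - 1)"
    unfolding gray_dist_def by (simp only: mod_0 mod_less) simp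
  then have "word_dist (word 0 0) (word 0 1) = (\<Sum>j<n. p ^ (k - 2) * (p - 1))"
    unfolding word_dist_def using one_less_q n
    by (intro sum.cong refl) (simp only: nth_word a_0 mod_0 mod_less add_0 lessThan_iff)
  then show ?thesis by (simp add: mult.commute mult.left_commute)
qed

lemma weight_pos: "n * (p - 1) * p ^ (k - 2) > 0"
  using n p2 by simp

section \<open>The four minimum distances\<close>

lemma min_dist_C: "min_dist (gray_word p k ` code_C \<zeta> (p ^ k) H) = n * (p - 1) * p ^ (k - 2)"
  unfolding code_C_eq
proof (rule min_dist_gray_eqI[OF p k, where L = n])
  show "(\<Sum>j<n. gray_dist p k (word 0 0 ! j) (word 0 1 ! j)) = n * (p - 1) * p ^ (k - 2)"
    using word_dist_first_row by (simp add: word_dist_def)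
  show "word 0 0 \<in> (\<lambda>(i, s). word i s) ` ({..<n} \<times> {..<p ^ k})"
       "word 0 1 \<in> (\<lambda>(i, s). word i s) ` ({..<n} \<times> {..<p ^ k})"
    by (rule image_eqI[of _ _ "(0, 0)"] image_eqI[of _ _ "(0, 1)"]; use n one_less_q q_pos in simp)+
  fix x y assume "x \<in> (\<lambda>(i, s). word i s) ` ({..<n} \<times> {..<p ^ k})"
    "y \<in> (\<lambda>(i, s). word i s) ` ({..<n} \<times> {..<p ^ k})" "x \<noteq> y"
  then obtain i s i' s' where "x = word i s" "y = word i' s'"
    "i < n" "i' < n" "s < p ^ k" "s' < p ^ k" "(i, s) \<noteq> (i', s')" by auto
  then show "n * (p - 1) * p ^ (k - 2) \<le> (\<Sum>j<n. gray_dist p k (x ! j) (y ! j))"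
    using word_dist_ge[of i i' s s'] unfolding \<open>x = _\<close> \<open>y = _\<close> word_dist_def by blast
next
  show "set w \<subseteq> {..<p ^ k}" if "w \<in> (\<lambda>(i, s). word i s) ` ({..<n} \<times> {..<p ^ k})" for w
    using that set_word by auto
qed (use weight_pos in auto)

text \<open>The appended entry never lowers a distance and ignores the shift, so the shifts of the
  first row by 0 and 1 still attain the bound.\<close>

lemma min_dist_D:
  assumes c: "c < n"
  shows "min_dist (gray_word p k ` code_D \<zeta> (p ^ k) c H) = n * (p - 1) * p ^ (k - 2)"
  unfolding code_D_eq[OF c]
proof (rule min_dist_gray_eqI[OF p k, where L = "Suc n"])
  let ?C = "(\<lambda>(i, s). word i s @ [a i c]) ` ({..<n} \<times> {..<p ^ k})"
  have eq: "(\<Sum>j<Suc n. gray_dist p k ((word i s @ [a i c]) ! j) ((word i' s' @ [a i' c]) ! j))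
      = word_dist (word i s) (word i' s') + gray_dist p k (a i c) (a i' c)" for i s i' s'
    by (simp add: word_dist_def nth_append)
  show "(\<Sum>j<Suc n. gray_dist p k ((word 0 0 @ [a 0 c]) ! j) ((word 0 1 @ [a 0 c]) ! j))
      = n * (p - 1) * p ^ (k - 2)"
    unfolding eq word_dist_first_row by (simp add: gray_dist_def)
  show "word 0 0 @ [a 0 c] \<in> ?C" "word 0 1 @ [a 0 c] \<in> ?C"
    by (rule image_eqI[of _ _ "(0, 0)"] image_eqI[of _ _ "(0, 1)"]; use n one_less_q q_pos in simp)+
  fix x y assume "x \<in> ?C" "y \<in> ?C" "x \<noteq> y"
  then obtain i s i' s' where "x = word i s @ [a i c]" "y = word i' s' @ [a i' c]"
    "i < n" "i' < n" "s < p ^ k" "s' < p ^ k" "(i, s) \<noteq> (i', s')" by auto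
  then show "n * (p - 1) * p ^ (k - 2) \<le> (\<Sum>j<Suc n. gray_dist p k (x ! j) (y ! j))"
    using word_dist_ge[of i i' s s'] unfolding \<open>x = _\<close> \<open>y = _\<close> eq by (meson trans_le_add1)
next
  show "set w \<subseteq> {..<p ^ k}"
    if "w \<in> (\<lambda>(i, s). word i s @ [a i c]) ` ({..<n} \<times> {..<p ^ k})" for w
    using that set_word a_less[OF _ c] by (auto simp: subset_iff)
qed (use weight_pos in auto)

text \<open>Column 0 of the exponents is 0, so the deleted entries are the shifts
  themselves.\<close>

lemma tl_word_dist:
  assumes "i < n" "i' < n" "s < p ^ k" "s' < p ^ k"
  shows "(\<Sum>j<n - 1. gray_dist p k (tl (word i s) ! j) (tl (word i' s') ! j)) + gray_dist p k s s'
    = word_dist (word i s) (word i' s')"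
proof -
  have S: "Suc (n - 1) = n" using n by simp
  have "(\<Sum>j<n - 1. gray_dist p k (tl (word i s) ! j) (tl (word i' s') ! j))
      = (\<Sum>j<n - 1. gray_dist p k (word i s ! Suc j) (word i' s' ! Suc j))"
    by (intro sum.cong) (auto simp: nth_tl)
  moreover have "word i s ! 0 = s" "word i' s' ! 0 = s'"
    using assms n by (simp_all add: nth_word a_0)
  moreover have "word_dist (word i s) (word i' s') = gray_dist p k (word i s ! 0) (word i' s' ! 0)
      + (\<Sum>j<n - 1. gray_dist p k (word i s ! Suc j) (word i' s' ! Suc j))"
    unfolding word_dist_def by (rule sum.lessThan_Suc_shift[of _ "n - 1", unfolded S])
  ultimately show ?thesis by simp
qed

lemma set_tl_word: "set (tl (word i s)) \<subseteq> {..<p ^ k}"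
  using set_word[of i s] by (cases "word i s") auto

text \<open>With both shifts 0 the deleted coordinate contributes nothing, so the code is
  equidistant; \<open>n \<ge> 2\<close> supplies a second row.\<close>

lemma min_dist_A:
  assumes n2: "n \<ge> 2"
  shows "min_dist (gray_word p k ` code_A \<zeta> (p ^ k) H) = n * (p - 1) * p ^ (k - 2)"
  unfolding code_A_eq
proof (rule min_dist_gray_eqI[OF p k, where L = "n - 1"])
  have eq: "(\<Sum>j<n - 1. gray_dist p k (tl (word i 0) ! j) (tl (word i' 0) ! j))
      = n * (p - 1) * p ^ (k - 2)" if "i < n" "i' < n" "i \<noteq> i'" for i i'
    using tl_word_dist[of i i' 0 0] word_dist_rows[OF that] that q_pos by (simp add: gray_dist_def)
  show "(\<Sum>j<n - 1. gray_dist p k (tl (word 0 0) ! j) (tl (word 1 0) ! j))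
      = n * (p - 1) * p ^ (k - 2)"
    using n2 by (intro eq) auto
  show "tl (word 0 0) \<in> (\<lambda>i. tl (word i 0)) ` {..<n}" "tl (word 1 0) \<in> (\<lambda>i. tl (word i 0)) ` {..<n}"
    using n2 by auto
  fix x y assume "x \<in> (\<lambda>i. tl (word i 0)) ` {..<n}" "y \<in> (\<lambda>i. tl (word i 0)) ` {..<n}" "x \<noteq> y"
  then obtain i i' where "x = tl (word i 0)" "y = tl (word i' 0)" "i < n" "i' < n" "i \<noteq> i'"
    by auto
  then show "n * (p - 1) * p ^ (k - 2) \<le> (\<Sum>j<n - 1. gray_dist p k (x ! j) (y ! j))"
    by (simp only: eq order_refl not_False_eq_True)
next
  show "set w \<subseteq> {..<p ^ k}" if "w \<in> (\<lambda>i. tl (word i 0)) ` {..<n}" for w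
    using that set_tl_word by blast
qed (use weight_pos in auto)

text \<open>Rests on \<open>p < 2 * (p - 1)\<close>, that is, \<open>p > 2\<close>. It makes the
  subtraction in \<open>min_dist_B\<close> exact and its result positive.\<close>

lemma weight_gt:
  assumes "n \<ge> 2"
  shows "p ^ (k - 1) < n * (p - 1) * p ^ (k - 2)"
proof -
  have "p ^ (k - 1) = p * p ^ (k - 2)" using k by (metis Suc_diff_Suc Suc_1 Suc_le_lessD diff_Suc_eq_diff_pred power_Suc)
  moreover have "p < 2 * (p - 1)" using p2 by simp
  then have "p < n * (p - 1)" using assms mult_le_mono1[of 2 n "p - 1"] by linarith
  ultimately show ?thesis using p2 by simp
qed

lemma min_dist_B:
  assumes n2: "n \<ge> 2"
  shows "min_dist (gray_word p k ` code_B \<zeta> (p ^ k) H) = n * (p - 1) * p ^ (k - 2) - p ^ (k - 1)"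
  unfolding code_B_eq
proof (rule min_dist_gray_eqI[OF p k, where L = "n - 1"])
  let ?C = "(\<lambda>(i, s). tl (word i s)) ` ({..<n} \<times> {..<p ^ k})"
  have M: "p ^ (k - 1) < p ^ k" "0 < p ^ (k - 1)"
    using p2 k by (auto intro: power_strict_increasing)
  \<comment> \<open>The shift \<open>p ^ (k - 1)\<close> is nonzero but 0 modulo
    \<open>p ^ (k - 1)\<close>, so the deleted coordinate carries the largest possible distance and
    the loss is maximal.\<close>
  have "gray_dist p k 0 (p ^ (k - 1)) = p ^ (k - 1)" using M by (simp add: gray_dist_def)
  then show "(\<Sum>j<n - 1. gray_dist p k (tl (word 0 0) ! j) (tl (word 1 (p ^ (k - 1))) ! j))
      = n * (p - 1) * p ^ (k - 2) - p ^ (k - 1)"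
    using tl_word_dist[of 0 1 0 "p ^ (k - 1)"] word_dist_rows[of 0 1 0 "p ^ (k - 1)"] n2 M(1) q_pos
    by linarith
  show "tl (word 0 0) \<in> ?C" "tl (word 1 (p ^ (k - 1))) \<in> ?C"
    by (rule image_eqI[of _ _ "(0, 0)"] image_eqI[of _ _ "(1, p ^ (k - 1))"];
        use n2 M(1) q_pos in simp)+
  show "0 < n * (p - 1) * p ^ (k - 2) - p ^ (k - 1)" using weight_gt[OF n2] by simp
  show "set w \<subseteq> {..<p ^ k}" if "w \<in> ?C" for w
    using that set_tl_word by auto
  fix x y assume "x \<in> ?C" "y \<in> ?C" "x \<noteq> y"
  then obtain i s i' s' where *: "x = tl (word i s)" "y = tl (word i' s')"
    "i < n" "i' < n" "s < p ^ k" "s' < p ^ k" "(i, s) \<noteq> (i', s')" by auto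
  then show "n * (p - 1) * p ^ (k - 2) - p ^ (k - 1) \<le> (\<Sum>j<n - 1. gray_dist p k (x ! j) (y ! j))"
    using word_dist_ge[of i i' s s'] tl_word_dist[of i i' s s'] gray_dist_bounds(1)[OF k, of p s s']
    unfolding \<open>x = _\<close> \<open>y = _\<close> by linarith
qed auto

end

text \<open>For \<open>n = 1\<close> deleting the only column leaves just the empty word, hence
  \<open>n \<ge> 2\<close> for the codes A and B. Integers keep the differences from
  truncating.\<close>

theorem corollary1:
  fixes p k n :: nat and \<zeta> :: complex and H :: "complex mat"
  assumes "prime p" and "p > 2" and "k \<ge> 2" and "n \<ge> 1"
    and "primitive_root_of_unity (p ^ k) \<zeta>"
    and "butson_hadamard (p ^ k) n H"
    and "normalized_mat n H"
  shows
    "(n \<ge> 2 \<longrightarrow>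
        int (min_dist (gray_word p k ` code_A \<zeta> (p ^ k) H))
          = int n * (int p - 1) * int p ^ (k - 2)) \<and>
     (n \<ge> 2 \<longrightarrow>
        int (min_dist (gray_word p k ` code_B \<zeta> (p ^ k) H))
          = int n * (int p - 1) * int p ^ (k - 2) - int p ^ (k - 1)) \<and>
     int (min_dist (gray_word p k ` code_C \<zeta> (p ^ k) H))
          = int n * (int p - 1) * int p ^ (k - 2) \<and>
     (n = p ^ k \<longrightarrow>
        (\<forall>c\<in>{1..<n}.
           int (min_dist (gray_word p k ` code_D \<zeta> (p ^ k) c H))
             \<in> {int p ^ (2 * k - 2) * (int p - 1),
                int p ^ (k - 2) * (int p ^ (k + 1) - int p ^ k + int p - 1)}))"
proof -
  interpret normalized_butson p k n \<zeta> H using assms by unfold_locales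
  have w: "int (n * (p - 1) * p ^ (k - 2)) = int n * (int p - 1) * int p ^ (k - 2)"
    using p2 by (simp add: of_nat_diff)
  have B: "int (n * (p - 1) * p ^ (k - 2) - p ^ (k - 1))
      = int n * (int p - 1) * int p ^ (k - 2) - int p ^ (k - 1)" if "n \<ge> 2"
    using weight_gt[OF that] by (simp only: of_nat_diff less_imp_le w of_nat_power)
  \<comment> \<open>Combines the exponents of \<open>n = p ^ k\<close> and
    \<open>p ^ (k - 2)\<close>; \<open>k \<ge> 2\<close> makes \<open>k - 2\<close> exact.\<close>
  have "k + (k - 2) = 2 * k - 2" using k by simp
  then have D: "int n * (int p - 1) * int p ^ (k - 2) = int p ^ (2 * k - 2) * (int p - 1)"
    if "n = p ^ k"
    using that by (simp add: mult.commute mult.left_commute flip: power_add)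
  show ?thesis
  proof (intro conjI impI ballI)
    fix c assume "n = p ^ k" "c \<in> {1..<n}"
    then show "int (min_dist (gray_word p k ` code_D \<zeta> (p ^ k) c H))
             \<in> {int p ^ (2 * k - 2) * (int p - 1),
                int p ^ (k - 2) * (int p ^ (k + 1) - int p ^ k + int p - 1)}"
      using min_dist_D[of c] w D by (metis atLeastLessThan_iff insertI1)
  qed (simp_all only: min_dist_A min_dist_B min_dist_C w B)
qed

end
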